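(* Let $\mathfrak g$ be a Lie algebra and $(V;\rho)$ a representation of $\mathfrak g$. If $(T,d)$ is a KD-structure on $\mathfrak g$ with respect to $(V;\rho)$, then $(T,\;S=d\circ T,\;N=T\circ d)$ is a KN-structure on $\mathfrak g$ with respect to $(V;\rho)$.
   Context: Everything is over a ground field $\mathbb K$. Let $\mathfrak g$ be a Lie algebra and $\rho:\mathfrak g\to\mathfrak{gl}(V)$ a representation, denoted $(V;\rho)$. A relative differential operator (with respect to $(V;\rho)$) is a linear map $d:\mathfrak g\to V$ with $d[x,y]=\rho(x)d(y)-\rho(y)d(x)$ for all $x,y\in\mathfrak g$. An $\mathcal O$-operator (with respect to $(V;\rho)$) is a linear map $T:V\to\mathfrak g$ with $[Tu,Tv]=T(\rho(Tu)v-\rho(Tv)u)$ for all $u,v\in V$. A Nijenhuis operator on $\mathfrak g$ is a linear map $N:\mathfrak g\to\mathfrak g$ with $[N(x),N(y)]=N\big([N(x),y]+[x,N(y)]-N[x,y]\big)$ for all $x,y\in\mathfrak g$. A KD-structure is a pair $(T,d)$, where $T$ is an $\mathcal O$-operator and $d$ a relative differential operator (both with respect to $(V;\rho)$), such that, with $N:=T\circ d$, the map $d\circ N$ is also a relative differential operator with respect to $(V;\rho)$. A dual-Nijenhuis pair on $\mathfrak g$ with representation $(V;\rho)$ is a pair $(N,S)$ with $N\in\mathfrak{gl}(\mathfrak g)$ a Nijenhuis operator and $S\in\mathfrak{gl}(V)$ satisfying $\rho(Nx)(Sv)=S(\rho(Nx)v)+\rho(x)(S^2v)-S(\rho(x)(Sv))$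 for all $x\in\mathfrak g$, $v\in V$. For a linear map $R:V\to\mathfrak g$ put $[u,v]^R:=\rho(Ru)v-\rho(Rv)u$, and for $S\in\mathfrak{gl}(V)$ put $[u,v]^R_S:=[Su,v]^R+[u,Sv]^R-S[u,v]^R$. A KN-structure (Kupershmidt-dual-Nijenhuis structure) on $\mathfrak g$ with respect to $(V;\rho)$ is a triple $(T,S,N)$ with $T:V\to\mathfrak g$ an $\mathcal O$-operator and $(N,S)$ a dual-Nijenhuis pair such that $N\circ T=T\circ S$ and $[u,v]^{N\circ T}=[u,v]^T_S$ for all $u,v\in V$. *)

theory Defs
  imports Main "HOL.Vector_Spaces"
begin

locale lie_algebra = vector_space scale
  for scale :: "'k::field \<Rightarrow> 'g::ab_group_add \<Rightarrow> 'g" +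
  fixes bracket :: "'g \<Rightarrow> 'g \<Rightarrow> 'g"
  assumes linear_bracket_left: "\<And>y. Vector_Spaces.linear scale scale (\<lambda>x. bracket x y)"
    and linear_bracket_right: "\<And>x. Vector_Spaces.linear scale scale (\<lambda>y. bracket x y)"
    and bracket_self: "\<And>x. bracket x x = 0"
    and jacobi: "\<And>x y z.
      bracket x (bracket y z) + bracket y (bracket z x) + bracket z (bracket x y) = 0"
begin

definition nijenhuis_operator :: "('g \<Rightarrow> 'g) \<Rightarrow> bool" where
  "nijenhuis_operator N \<longleftrightarrow>
     Vector_Spaces.linear scale scale N \<and>
     (\<forall>x y. bracket (N x) (N y) = N (bracket (N x) y + bracket x (N y) - N (bracket x y)))"

end

text \<open>The endomorphism of \<open>V\<close> attached to \<open>x\<close> is \<open>\<rho> x\<close>; since the vector space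
  structure of \<open>gl(V)\<close> is pointwise, linearity of \<open>\<rho>\<close> itself is linearity of
  \<open>x \<mapsto> \<rho> x v\<close> for each \<open>v\<close>.\<close>

locale lie_representation =
  lie_algebra scaleg bracket + V: vector_space scalev
  for scaleg :: "'k::field \<Rightarrow> 'g::ab_group_add \<Rightarrow> 'g"
    and bracket :: "'g \<Rightarrow> 'g \<Rightarrow> 'g"
    and scalev :: "'k \<Rightarrow> 'v::ab_group_add \<Rightarrow> 'v" +
  fixes \<rho> :: "'g \<Rightarrow> 'v \<Rightarrow> 'v"
  assumes linear_rho: "\<And>v. Vector_Spaces.linear scaleg scalev (\<lambda>x. \<rho> x v)"
    and linear_rho_apply: "\<And>x. Vector_Spaces.linear scalev scalev (\<rho> x)"
    and rho_bracket: "\<And>x y v. \<rho> (bracket x y) v = \<rho> x (\<rho> y v) - \<rho> y (\<rho> x v)"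
begin

definition relative_differential_operator :: "('g \<Rightarrow> 'v) \<Rightarrow> bool" where
  "relative_differential_operator d \<longleftrightarrow>
     Vector_Spaces.linear scaleg scalev d \<and>
     (\<forall>x y. d (bracket x y) = \<rho> x (d y) - \<rho> y (d x))"

definition O_operator :: "('v \<Rightarrow> 'g) \<Rightarrow> bool" where
  "O_operator T \<longleftrightarrow>
     Vector_Spaces.linear scalev scaleg T \<and>
     (\<forall>u v. bracket (T u) (T v) = T (\<rho> (T u) v - \<rho> (T v) u))"

definition KD_structure :: "('v \<Rightarrow> 'g) \<Rightarrow> ('g \<Rightarrow> 'v) \<Rightarrow> bool" where
  "KD_structure T d \<longleftrightarrow>
     O_operator T \<and> relative_differential_operator d \<and>
     relative_differential_operator (d \<circ> (T \<circ> d))"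

definition dual_nijenhuis_pair :: "('g \<Rightarrow> 'g) \<Rightarrow> ('v \<Rightarrow> 'v) \<Rightarrow> bool" where
  "dual_nijenhuis_pair N S \<longleftrightarrow>
     nijenhuis_operator N \<and> Vector_Spaces.linear scalev scalev S \<and>
     (\<forall>x v. \<rho> (N x) (S v) = S (\<rho> (N x) v) + \<rho> x (S (S v)) - S (\<rho> x (S v)))"

definition bracketV :: "('v \<Rightarrow> 'g) \<Rightarrow> 'v \<Rightarrow> 'v \<Rightarrow> 'v" where
  "bracketV R u v = \<rho> (R u) v - \<rho> (R v) u"

definition deformed_bracketV :: "('v \<Rightarrow> 'g) \<Rightarrow> ('v \<Rightarrow> 'v) \<Rightarrow> 'v \<Rightarrow> 'v \<Rightarrow> 'v" where
  "deformed_bracketV R S u v = bracketV R (S u) v + bracketV R u (S v) - S (bracketV R u v)"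

definition KN_structure :: "('v \<Rightarrow> 'g) \<Rightarrow> ('v \<Rightarrow> 'v) \<Rightarrow> ('g \<Rightarrow> 'g) \<Rightarrow> bool" where
  "KN_structure T S N \<longleftrightarrow>
     O_operator T \<and> dual_nijenhuis_pair N S \<and> N \<circ> T = T \<circ> S \<and>
     (\<forall>u v. bracketV (N \<circ> T) u v = deformed_bracketV T S u v)"

end

end

theory Submission
  imports Defs
begin

text \<open>
  Write \<open>N = T \<circ> d\<close> and \<open>S = d \<circ> T\<close>. The differential operator identity for \<open>d\<close> turns
  \<open>\<rho> x (d y) - \<rho> y (d x)\<close> into a value of \<open>d\<close>, and the \<open>\<O>\<close>-operator identity turns
  \<open>T (\<rho> (T u) v - \<rho> (T v) u)\<close> into a bracket, so each axiom of a KN-structure reduces to a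
  cancellation once these two rules have been applied. The compatibility \<open>N \<circ> T = T \<circ> S\<close> is
  associativity of composition. The equality of the two brackets on \<open>V\<close> says that \<open>d\<close> satisfies
  its identity on the pairs \<open>(T u, T v)\<close>, and so uses only that \<open>T\<close> is an \<open>\<O>\<close>-operator and
  \<open>d\<close> a differential operator.

  The remaining two axioms contain second-order terms, and these are what the hypothesis on
  \<open>d \<circ> N\<close> controls. In the Nijenhuis identity it says that in
  \<open>d ([N x, y] + [x, N y] - N [x, y])\<close> the terms \<open>\<rho> x (d (N y)) - \<rho> y (d (N x))\<close> cancel, leaving
  \<open>\<rho> (N x) (d y) - \<rho> (N y) (d x)\<close>; applying \<open>T\<close> gives \<open>[T (d x), T (d y)] = [N x, N y]\<close>. In the
  identity for \<open>S\<close> it is applied to the pair \<open>(x, T v)\<close>, since \<open>d (N [x, T v]) = S (d [x, T v])\<close>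
  and \<open>d (N (T v)) = S (S v)\<close>.
\<close>

context lie_representation
begin

lemma KD_structure_imp_nijenhuis_operator:
  assumes "KD_structure T d"
  shows "nijenhuis_operator (T \<circ> d)"
  unfolding nijenhuis_operator_def
proof (intro conjI allI)
  have O: "O_operator T" and D: "relative_differential_operator d"
    and DN: "relative_differential_operator (d \<circ> (T \<circ> d))"
    using assms by (simp_all add: KD_structure_def)
  have linT: "Vector_Spaces.linear scalev scaleg T"
    using O by (simp add: O_operator_def)
  have lind: "Vector_Spaces.linear scaleg scalev d"
    using D by (simp add: relative_differential_operator_def)
  interpret d: Vector_Spaces.linear scaleg scalev d by (rule lind)
  show "Vector_Spaces.linear scaleg scaleg (T \<circ> d)"
    using lind linT by (rule Vector_Spaces.linear_compose)
  fix x y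
  let ?N = "T \<circ> d"
  have "d (bracket (?N x) y + bracket x (?N y) - ?N (bracket x y)) =
      (\<rho> (?N x) (d y) - \<rho> y (d (?N x))) + (\<rho> x (d (?N y)) - \<rho> (?N y) (d x))
      - (\<rho> x (d (?N y)) - \<rho> y (d (?N x)))"
    using D DN by (simp add: relative_differential_operator_def d.add d.diff)
  also have "\<dots> = \<rho> (?N x) (d y) - \<rho> (?N y) (d x)"
    by simp
  finally show "bracket (?N x) (?N y) =
      ?N (bracket (?N x) y + bracket x (?N y) - ?N (bracket x y))"
    using O by (simp add: O_operator_def)
qed

text \<open>The two brackets on \<open>V\<close> differ by the defect of
  \<open>d [T u, T v] = \<rho> (T u) (d (T v)) - \<rho> (T v) (d (T u))\<close>, where \<open>[T u, T v] = T [u, v]\<^sup>T\<close>.\<close>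

lemma bracketV_comp_eq_deformed_bracketV:
  assumes "O_operator T" and "relative_differential_operator d"
  shows "bracketV (T \<circ> d \<circ> T) u v = deformed_bracketV T (d \<circ> T) u v"
proof -
  have "d (T (bracketV T u v)) = d (bracket (T u) (T v))"
    using assms(1) by (simp add: O_operator_def bracketV_def)
  also have "\<dots> = \<rho> (T u) (d (T v)) - \<rho> (T v) (d (T u))"
    using assms(2) by (simp add: relative_differential_operator_def)
  finally show ?thesis
    by (simp add: deformed_bracketV_def) (simp add: bracketV_def)
qed

text \<open>The term \<open>S (\<rho> (N x) v)\<close> is the first half of \<open>d (T [d x, v]\<^sup>T) = d [N x, T v]\<close>. The other
  half, \<open>S (\<rho> (T v) (d x))\<close>, joins \<open>S (\<rho> x (S v))\<close> to form \<open>S (d [x, T v])\<close>, which the identity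
  for \<open>d \<circ> T \<circ> d\<close> evaluates.\<close>

lemma KD_structure_imp_dual_nijenhuis_pair:
  assumes "KD_structure T d"
  shows "dual_nijenhuis_pair (T \<circ> d) (d \<circ> T)"
  unfolding dual_nijenhuis_pair_def
proof (intro conjI allI)
  have O: "O_operator T" and D: "relative_differential_operator d"
    and DN: "relative_differential_operator (d \<circ> (T \<circ> d))"
    using assms by (simp_all add: KD_structure_def)
  have linT: "Vector_Spaces.linear scalev scaleg T"
    using O by (simp add: O_operator_def)
  have lind: "Vector_Spaces.linear scaleg scalev d"
    using D by (simp add: relative_differential_operator_def)
  have linS: "Vector_Spaces.linear scalev scalev (d \<circ> T)"
    using linT lind by (rule Vector_Spaces.linear_compose)
  interpret S: Vector_Spaces.linear scalev scalev "d \<circ> T" by (rule linS)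
  show "nijenhuis_operator (T \<circ> d)"
    using assms by (rule KD_structure_imp_nijenhuis_operator)
  show "Vector_Spaces.linear scalev scalev (d \<circ> T)"
    by (rule linS)
  fix x v
  let ?N = "T \<circ> d" and ?S = "d \<circ> T"
  have first_order: "?S (\<rho> (?N x) v) - ?S (\<rho> (T v) (d x)) =
      \<rho> (?N x) (?S v) - \<rho> (T v) (d (?N x))"
  proof -
    have "?S (\<rho> (?N x) v) - ?S (\<rho> (T v) (d x)) = d (T (\<rho> (T (d x)) v - \<rho> (T v) (d x)))"
      using S.diff[of "\<rho> (?N x) v" "\<rho> (T v) (d x)"] by simp
    also have "\<dots> = d (bracket (T (d x)) (T v))"
      using O by (simp add: O_operator_def)
    finally show ?thesis
      using D by (simp add: relative_differential_operator_def)
  qed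
  have second_order: "?S (\<rho> x (?S v)) - ?S (\<rho> (T v) (d x)) =
      \<rho> x (?S (?S v)) - \<rho> (T v) (d (?N x))"
  proof -
    have "?S (\<rho> x (?S v)) - ?S (\<rho> (T v) (d x)) = ?S (\<rho> x (d (T v)) - \<rho> (T v) (d x))"
      using S.diff[of "\<rho> x (?S v)" "\<rho> (T v) (d x)"] by simp
    also have "\<dots> = (d \<circ> (T \<circ> d)) (bracket x (T v))"
      using D by (simp add: relative_differential_operator_def)
    also have "\<dots> = \<rho> x ((d \<circ> (T \<circ> d)) (T v)) - \<rho> (T v) ((d \<circ> (T \<circ> d)) x)"
      using DN unfolding relative_differential_operator_def by blast
    finally show ?thesis
      by simp
  qed
  have "\<rho> (?N x) (?S v) = ?S (\<rho> (?N x) v) - ?S (\<rho> (T v) (d x)) + \<rho> (T v) (d (?N x))"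
    unfolding first_order by (rule diff_add_cancel[symmetric])
  moreover have "?S (\<rho> x (?S v)) =
      \<rho> x (?S (?S v)) - \<rho> (T v) (d (?N x)) + ?S (\<rho> (T v) (d x))"
    unfolding second_order[symmetric] by (rule diff_add_cancel[symmetric])
  ultimately show "\<rho> (?N x) (?S v) = ?S (\<rho> (?N x) v) + \<rho> x (?S (?S v)) - ?S (\<rho> x (?S v))"
    by (simp del: comp_apply)
qed

end

theorem proposition3p11:
  fixes scaleg :: "'k::field \<Rightarrow> 'g::ab_group_add \<Rightarrow> 'g"
    and bracket :: "'g \<Rightarrow> 'g \<Rightarrow> 'g"
    and scalev :: "'k \<Rightarrow> 'v::ab_group_add \<Rightarrow> 'v"
    and \<rho> :: "'g \<Rightarrow> 'v \<Rightarrow> 'v"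
    and T :: "'v \<Rightarrow> 'g"
    and d :: "'g \<Rightarrow> 'v"
  assumes "lie_representation scaleg bracket scalev \<rho>"
    and "lie_representation.KD_structure scaleg bracket scalev \<rho> T d"
  shows "lie_representation.KN_structure scaleg bracket scalev \<rho> T (d \<circ> T) (T \<circ> d)"
proof -
  interpret lie_representation scaleg bracket scalev \<rho> by (rule assms(1))
  have O: "O_operator T" and D: "relative_differential_operator d"
    using assms(2) by (simp_all add: KD_structure_def)
  show ?thesis
    unfolding KN_structure_def
    using O KD_structure_imp_dual_nijenhuis_pair[OF assms(2)]
      bracketV_comp_eq_deformed_bracketV[OF O D] comp_assoc[of T d T]
    by blast
qed

end
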